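(* Let $n\in\mathbb{N}$, let $\lambda,\mu\in\mathbb{Z}^n$, and let $\mathbf{x}\in GT(\lambda,\mu)$ have tiling $\mathscr{P}$ containing $s$ free tiles, with tiling matrix $A_{\mathscr{P}}$. Then the following conditions are equivalent: (a) $\mathbf{x}$ is a vertex of $GT(\lambda,\mu)$; (b) $A_{\mathscr{P}}$ (as a linear map on $\mathbb{R}^s$) has trivial kernel; i.e., for some $s\times s$ submatrix $\tilde A$ of $A_{\mathscr{P}}$, $\det\tilde A\neq 0$.
   Context: For $n\in\mathbb{N}$, $X_n$ is the real vector space of all triangular arrays $(x_{ij})_{1\le i\le j\le n}$ with $x_{ij}\in\mathbb{R}$, so $X_n \cong \mathbb{R}^{n(n+1)/2}$. For fixed $j$, the entries $x_{1j},\dots,x_{jj}$ form the $j$th row; the $n$th row is the top row and $x_{11}$ is the bottom row. A Gelfand--Tsetlin pattern (GT-pattern) is an array $(x_{ij})_{1\le i\le j\le n}\in X_n$ with $x_{ij}\ge 0$ for $1\le i\le j\le n$ and $x_{i,j+1}\ge x_{ij}\ge x_{i+1,j+1}$ for $1\le i\le j\le n-1$. For $\lambda,\mu\in\mathbb{Z}^n$, the Gelfand--Tsetlin polytope (GT-polytope) $GT(\lambda,\mu)\subset X_n$ is the convex polytope of all GT-patterns $(x_{ij})$ with $x_{in}=\lambda_i$ for $1\le i\le n$, $x_{11}=\mu_1$, and $\sum_{i=1}^{j}x_{ij}-\sum_{i=1}^{j-1}x_{i,j-1}=\mu_j$ for $2\le j\le n$. The tiling $\mathscr{P}$ of a GT-pattern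 $\mathbf{x}\in X_n$ is the partition of $\{(i,j)\in\mathbb{Z}^2: 1\le i\le j\le n\}$ into subsets, called tiles, obtained by grouping together entries that are equal and adjacent: two pairs $(i,j),(\tilde i,\tilde j)$ in this index set are in the same tile iff there is a sequence of pairs $(i,j)=(i_1,j_1),(i_2,j_2),\dots,(i_r,j_r)=(\tilde i,\tilde j)$ in the index set such that, for each $k\in\{1,\dots,r-1\}$, $x_{i_{k+1}j_{k+1}}=x_{i_kj_k}$ and $(i_{k+1},j_{k+1})\in\{(i_k+1,j_k+1),(i_k,j_k+1),(i_k-1,j_k-1),(i_k,j_k-1)\}$. The free tiles $P_1,\dots,P_s$ of $\mathscr{P}$ are the tiles that do not contain $(1,1)$ and do not contain $(i,n)$ for any $1\le i\le n$ (the order of indexing is immaterial). The tiling matrix $A_{\mathscr{P}}=(a_{jk})_{2\le j\le n-1,\,1\le k\le s}$ is defined by $a_{jk}=\#\{i:(i,j)\in P_k\}$. When $s=0$, the kernel is trivial and the determinant of the empty matrix is $1$. *)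

theory Defs
  imports
    "HOL-Analysis.Polytope"
    "HOL-Analysis.Finite_Function_Topology"
    "Jordan_Normal_Form.Determinant"
    "Jordan_Normal_Form.Matrix_Kernel"
    "Jordan_Normal_Form.DL_Submatrix"
begin

definition tri_index :: "nat \<Rightarrow> (nat \<times> nat) set" where
  "tri_index n = {(i, j). 1 \<le> i \<and> i \<le> j \<and> j \<le> n}"

text \<open>
  The size \<open>n\<close> of a triangular array is a term, so all arrays live in the real vector space of
  finitely supported functions on pairs of naturals; \<open>tri_arrays n\<close> is the linear subspace of
  those supported in the \<open>n\<close>-th triangle, of dimension \<open>n(n+1)/2\<close>. Note that the second index
  is the row.
\<close>

type_synonym tri_array = "(nat \<times> nat) \<Rightarrow>\<^sub>0 real"

abbreviation entry :: "tri_array \<Rightarrow> nat \<Rightarrow> nat \<Rightarrow> real" where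
  "entry x i j \<equiv> Poly_Mapping.lookup x (i, j)"

definition tri_arrays :: "nat \<Rightarrow> tri_array set" where
  "tri_arrays n = {x. Poly_Mapping.keys x \<subseteq> tri_index n}"

definition GT_pattern :: "nat \<Rightarrow> tri_array \<Rightarrow> bool" where
  "GT_pattern n x \<longleftrightarrow>
     x \<in> tri_arrays n \<and>
     (\<forall>i j. 1 \<le> i \<and> i \<le> j \<and> j \<le> n \<longrightarrow> 0 \<le> entry x i j) \<and>
     (\<forall>i j. 1 \<le> i \<and> i \<le> j \<and> j \<le> n - 1 \<longrightarrow>
        entry x i (j + 1) \<ge> entry x i j \<and> entry x i j \<ge> entry x (i + 1) (j + 1))"

text \<open>
  An integer vector of length \<open>n\<close> is given by a function of which only the values at
  \<open>1, \<dots>, n\<close> matter.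
\<close>

definition GT_polytope :: "nat \<Rightarrow> (nat \<Rightarrow> int) \<Rightarrow> (nat \<Rightarrow> int) \<Rightarrow> tri_array set" where
  "GT_polytope n l m = {x. GT_pattern n x \<and>
     (\<forall>i\<in>{1..n}. entry x i n = of_int (l i)) \<and>
     entry x 1 1 = of_int (m 1) \<and>
     (\<forall>j\<in>{2..n}. (\<Sum>i=1..j. entry x i j) - (\<Sum>i=1..j-1. entry x i (j - 1)) = of_int (m j))}"

text \<open>
  One step of a sequence linking two positions of a tile. The subtractions do not truncate, as
  both positions lie in the triangle.
\<close>

definition tile_step :: "nat \<Rightarrow> tri_array \<Rightarrow> ((nat \<times> nat) \<times> (nat \<times> nat)) set" where
  "tile_step n x = {((i, j), (i', j')).
     (i, j) \<in> tri_index n \<and> (i', j') \<in> tri_index n \<and>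
     entry x i' j' = entry x i j \<and>
     (i', j') \<in> {(i + 1, j + 1), (i, j + 1), (i - 1, j - 1), (i, j - 1)}}"

definition tiling :: "nat \<Rightarrow> tri_array \<Rightarrow> (nat \<times> nat) set set" where
  "tiling n x = tri_index n // (tile_step n x)\<^sup>*"

definition free_tiles :: "nat \<Rightarrow> tri_array \<Rightarrow> (nat \<times> nat) set set" where
  "free_tiles n x = {P \<in> tiling n x. (1, 1) \<notin> P \<and> (\<forall>i\<in>{1..n}. (i, n) \<notin> P)}"

text \<open>
  The matrix for an enumeration \<open>Ps\<close> of the free tiles. Its rows are indexed by \<open>2, \<dots>, n - 1\<close> in
  the mathematics; since matrix indices start at \<open>0\<close>, row \<open>r\<close> of the matrix is row \<open>j = r + 2\<close>
  of the triangle. There are no rows if \<open>n \<le> 2\<close>.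
\<close>

definition tiling_matrix :: "nat \<Rightarrow> (nat \<times> nat) set list \<Rightarrow> real mat" where
  "tiling_matrix n Ps =
     mat (n - 2) (length Ps) (\<lambda>(r, k). of_nat (card {i. (i, r + 2) \<in> Ps ! k}))"

end

theory Submission
  imports Defs
begin

text \<open>
  A direction that can be followed both ways from \<open>x\<close> inside the polytope is constant on tiles,
  vanishes on the tiles that are not free, and has zero row sums. Conversely, every such direction
  is admissible for small steps, as the inequalities between different tiles are strict and free
  tiles have positive values. These directions are the weights on free tiles in the kernel of the
  tiling matrix, so \<open>x\<close> is a vertex iff this kernel is trivial. A minimal set of rows that still has
  trivial kernel has exactly \<open>s\<close> elements: with fewer there is a kernel vector, and with more some
  row depends on the others and can be dropped. This gives the nonzero minor.
\<close>

section \<open>Full-rank minors\<close>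

text \<open>Gaussian elimination, one equation at a time: a zero equation imposes nothing, and any
  other one is solved for an unknown \<open>k0\<close>, which leaves one equation and one unknown
  fewer.\<close>

lemma wide_system_has_nonzero_solution:
  fixes a :: "'r \<Rightarrow> 'c \<Rightarrow> 'a::field"
  assumes "finite I" "finite K" "card I < card K"
  shows "\<exists>v. (\<exists>k\<in>K. v k \<noteq> 0) \<and> (\<forall>r\<in>I. (\<Sum>k\<in>K. a r k * v k) = 0)"
  using assms
proof (induction I arbitrary: K a rule: finite_induct)
  case empty
  then have "K \<noteq> {}" by auto
  then show ?case by (intro exI[of _ "\<lambda>_. 1"]) auto
next
  case (insert r I)
  show ?case
  proof (cases "\<forall>k\<in>K. a r k = 0")
    case True
    have "card I < card K" using insert by simp
    then obtain v where v: "\<exists>k\<in>K. v k \<noteq> 0" "\<forall>q\<in>I. (\<Sum>k\<in>K. a q k * v k) = 0"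
      using insert.IH[OF insert.prems(1), of a] by blast
    moreover have "(\<Sum>k\<in>K. a r k * v k) = 0" using True by simp
    ultimately show ?thesis by (intro exI[of _ v]) simp
  next
    case False
    then obtain k0 where k0: "k0 \<in> K" "a r k0 \<noteq> 0" by blast
    define K' where "K' = K - {k0}"
    have fin: "finite K'" using insert.prems by (simp add: K'_def)
    have card: "card I < card K'" using insert k0 by (simp add: K'_def)
    \<comment> \<open>The reduced system results from subtracting the multiple of equation
      \<open>r\<close> that cancels the coefficient of \<open>k0\<close>.\<close>
    obtain v where v: "\<exists>k\<in>K'. v k \<noteq> 0"
      and sol: "\<forall>q\<in>I. (\<Sum>k\<in>K'. (a q k - a q k0 * a r k / a r k0) * v k) = 0"
      using insert.IH[OF fin card, of "\<lambda>q k. a q k - a q k0 * a r k / a r k0"] by blast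
    define S where "S q = (\<Sum>k\<in>K'. a q k * v k)" for q
    \<comment> \<open>The value at \<open>k0\<close> is the one that equation \<open>r\<close>
      dictates once the other unknowns are given by \<open>v\<close>.\<close>
    define w where "w = v(k0 := - S r / a r k0)"
    have sum_w: "(\<Sum>k\<in>K. a q k * w k) = S q - a q k0 * S r / a r k0" for q
    proof -
      have "(\<Sum>k\<in>K. a q k * w k) = a q k0 * w k0 + (\<Sum>k\<in>K'. a q k * w k)"
        unfolding K'_def by (rule sum.remove) (use insert.prems k0 in auto)
      also have "(\<Sum>k\<in>K'. a q k * w k) = S q"
        unfolding S_def by (rule sum.cong) (auto simp: w_def K'_def)
      finally show ?thesis by (simp add: w_def)
    qed
    have "S q - a q k0 * S r / a r k0 = 0" if "q \<in> I" for q
    proof -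
      have "(\<Sum>k\<in>K'. (a q k - a q k0 * a r k / a r k0) * v k) = S q - a q k0 * S r / a r k0"
        by (simp add: S_def sum_distrib_left sum_divide_distrib sum_subtractf algebra_simps)
      with sol that show ?thesis by simp
    qed
    moreover have "S r - a r k0 * S r / a r k0 = 0" using k0 by simp
    moreover have "\<exists>k\<in>K. w k \<noteq> 0" using v by (auto simp: w_def K'_def)
    ultimately show ?thesis by (intro exI[of _ w]) (auto simp: sum_w)
  qed
qed

text \<open>Both bounds on the size of a smallest injective subsystem come from
  \<open>wide_system_has_nonzero_solution\<close>, applied once to the system and once to its
  transpose.\<close>

lemma injective_system_has_square_subsystem:
  fixes a :: "'r \<Rightarrow> 'c \<Rightarrow> 'a::field"
  assumes "finite R" "finite K"
    and "\<And>v. \<forall>r\<in>R. (\<Sum>k\<in>K. a r k * v k) = 0 \<Longrightarrow> \<forall>k\<in>K. v k = 0"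
  obtains I where "I \<subseteq> R" "card I = card K"
    "\<And>v. \<forall>r\<in>I. (\<Sum>k\<in>K. a r k * v k) = 0 \<Longrightarrow> \<forall>k\<in>K. v k = 0"
proof -
  define inj where "inj I \<longleftrightarrow>
    (\<forall>v. (\<forall>r\<in>I. (\<Sum>k\<in>K. a r k * v k) = 0) \<longrightarrow> (\<forall>k\<in>K. v k = 0))" for I
  have "R \<subseteq> R \<and> inj R" using assms(3) unfolding inj_def by blast
  from ex_has_least_nat[of "\<lambda>I. I \<subseteq> R \<and> inj I", OF this, of card]
  obtain I where I: "I \<subseteq> R" "inj I"
    and least: "\<And>J. J \<subseteq> R \<Longrightarrow> inj J \<Longrightarrow> card I \<le> card J" by blast
  have injI: "\<forall>k\<in>K. v k = 0" if "\<forall>r\<in>I. (\<Sum>k\<in>K. a r k * v k) = 0" for v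
    using I(2) that unfolding inj_def by blast
  have fin: "finite I" using I(1) \<open>finite R\<close> by (rule finite_subset)
  have "\<not> card I < card K"
    using wide_system_has_nonzero_solution[OF fin \<open>finite K\<close>, of a] injI by blast
  moreover have "\<not> card K < card I"
  proof
    assume "card K < card I"
    \<comment> \<open>A solution of the transposed system is a linear dependence among the rows in
      \<open>I\<close>; row \<open>r0\<close> occurs in it with nonzero coefficient.\<close>
    then obtain u r0 where r0: "r0 \<in> I" "u r0 \<noteq> 0"
      and u: "\<forall>k\<in>K. (\<Sum>r\<in>I. a r k * u r) = 0"
      using wide_system_has_nonzero_solution[OF \<open>finite K\<close> fin, of "\<lambda>k r. a r k"] by blast
    have "inj (I - {r0})"
      unfolding inj_def
    proof (intro allI impI)
      fix v assume v: "\<forall>r\<in>I - {r0}. (\<Sum>k\<in>K. a r k * v k) = 0"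
      \<comment> \<open>By the dependence, a vector annihilated by the other rows is annihilated by
        row \<open>r0\<close> too, so dropping \<open>r0\<close> preserves injectivity.\<close>
      have "u r0 * (\<Sum>k\<in>K. a r0 k * v k) = (\<Sum>r\<in>I. u r * (\<Sum>k\<in>K. a r k * v k))"
        using v by (subst sum.remove[OF fin r0(1)]) simp
      also have "\<dots> = (\<Sum>k\<in>K. v k * (\<Sum>r\<in>I. a r k * u r))"
        by (simp add: sum_distrib_left mult_ac) (rule sum.swap)
      also have "\<dots> = 0" using u by simp
      finally have "(\<Sum>k\<in>K. a r0 k * v k) = 0" using r0(2) by simp
      with v have "\<forall>r\<in>I. (\<Sum>k\<in>K. a r k * v k) = 0" by blast
      then show "\<forall>k\<in>K. v k = 0" by (rule injI)
    qed
    moreover have "I - {r0} \<subseteq> R" using I(1) by blast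
    ultimately have "card I \<le> card (I - {r0})" by (intro least)
    then show False using card_Diff1_less[OF fin r0(1)] by simp
  qed
  ultimately have "card I = card K" by simp
  from that[OF I(1) this injI] show thesis .
qed

section \<open>Kernels and minors of matrices\<close>

lemma mat_kernel_trivial_iff:
  fixes A :: "'a::comm_ring_1 mat"
  assumes A: "A \<in> carrier_mat nr nc"
  shows "mat_kernel A = {0\<^sub>v nc} \<longleftrightarrow>
    (\<forall>f. (\<forall>r<nr. (\<Sum>k<nc. A $$ (r, k) * f k) = 0) \<longrightarrow> (\<forall>k<nc. f k = 0))"
proof -
  have mem: "vec nc f \<in> mat_kernel A \<longleftrightarrow> (\<forall>r<nr. (\<Sum>k<nc. A $$ (r, k) * f k) = 0)" for f
    unfolding mat_kernel[OF A] using A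
    by (auto simp: vec_eq_iff scalar_prod_def atLeast0LessThan)
  have zero: "vec nc f = 0\<^sub>v nc \<longleftrightarrow> (\<forall>k<nc. f k = 0)" for f
    by (auto simp: vec_eq_iff)
  have ex: "\<exists>f. v = vec nc f" if "v \<in> mat_kernel A" for v
    using mat_kernelD[OF A that] by (intro exI[of _ "\<lambda>i. v $ i"]) (auto simp: vec_eq_iff)
  have "0\<^sub>v nc \<in> mat_kernel A"
    unfolding mat_kernel[OF A] using A by (auto simp: vec_eq_iff)
  then have "mat_kernel A = {0\<^sub>v nc} \<longleftrightarrow> (\<forall>v\<in>mat_kernel A. v = 0\<^sub>v nc)" by blast
  also have "\<dots> \<longleftrightarrow> (\<forall>f. vec nc f \<in> mat_kernel A \<longrightarrow> vec nc f = 0\<^sub>v nc)"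
    using ex by metis
  finally show ?thesis unfolding mem zero .
qed

lemma det_nonzero_iff_mat_kernel:
  fixes A :: "'a::field mat"
  assumes A: "A \<in> carrier_mat n n"
  shows "det A \<noteq> 0 \<longleftrightarrow> mat_kernel A = {0\<^sub>v n}"
  unfolding det_0_iff_vec_prod_zero_field[OF A] mat_kernel[OF A] using A
  by auto

text \<open>A square subsystem on all columns yields an invertible submatrix. Conversely, an
  \<open>s\<close> by \<open>s\<close> submatrix of a matrix with \<open>s\<close> columns omits no
  column, so its kernel contains that of \<open>A\<close>.\<close>

lemma mat_kernel_trivial_iff_minor:
  fixes A :: "'a::field mat"
  assumes A: "A \<in> carrier_mat m s"
  shows "mat_kernel A = {0\<^sub>v s} \<longleftrightarrow>
    (\<exists>I J. submatrix A I J \<in> carrier_mat s s \<and> det (submatrix A I J) \<noteq> 0)"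
proof
  assume "mat_kernel A = {0\<^sub>v s}"
  then have inj: "\<forall>k\<in>{..<s}. f k = 0" if "\<forall>r\<in>{..<m}. (\<Sum>k<s. A $$ (r, k) * f k) = 0" for f
    using that unfolding mat_kernel_trivial_iff[OF A] by auto
  obtain I where I: "I \<subseteq> {..<m}" "card I = s"
    and injI: "\<And>f. \<forall>r\<in>I. (\<Sum>k<s. A $$ (r, k) * f k) = 0 \<Longrightarrow> \<forall>k\<in>{..<s}. f k = 0"
    using injective_system_has_square_subsystem[of "{..<m}" "{..<s}" "\<lambda>r k. A $$ (r, k)"] inj
    by auto
  define B where "B = submatrix A I UNIV"
  have rows: "{i. i < dim_row A \<and> i \<in> I} = I" using I A by auto
  then have B: "B \<in> carrier_mat s s" using I A by (auto simp: B_def dim_submatrix)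
  have "mat_kernel B = {0\<^sub>v s}"
    unfolding mat_kernel_trivial_iff[OF B]
  proof (intro allI impI)
    fix f k assume f: "\<forall>r<s. (\<Sum>k<s. B $$ (r, k) * f k) = 0" and "k < s"
    have "(\<Sum>k<s. A $$ (r, k) * f k) = 0" if "r \<in> I" for r
    proof -
      \<comment> \<open>\<open>submatrix\<close> keeps the order of the rows, so row
        \<open>r\<close> of \<open>A\<close> becomes row \<open>card {a \<in> I. a < r}\<close> of
        \<open>B\<close>, counted from zero.\<close>
      have "{a \<in> I. a < r} \<subset> I" using that by auto
      then have "card {a \<in> I. a < r} < s"
        using I by (metis finite_lessThan finite_subset psubset_card_mono)
      moreover have "B $$ (card {a \<in> I. a < r}, k) = A $$ (r, k)" if "k < s" for k
        using submatrix_index_card[of r A k I UNIV] \<open>r \<in> I\<close> that I A by (auto simp: B_def)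
      ultimately show ?thesis using f by (auto dest!: spec[of _ "card {a \<in> I. a < r}"])
    qed
    then show "f k = 0" using injI \<open>k < s\<close> by blast
  qed
  with B show "\<exists>I J. submatrix A I J \<in> carrier_mat s s \<and> det (submatrix A I J) \<noteq> 0"
    unfolding B_def using det_nonzero_iff_mat_kernel by blast
next
  assume "\<exists>I J. submatrix A I J \<in> carrier_mat s s \<and> det (submatrix A I J) \<noteq> 0"
  then obtain I J where B: "submatrix A I J \<in> carrier_mat s s"
    and "det (submatrix A I J) \<noteq> 0" by blast
  then have ker: "mat_kernel (submatrix A I J) = {0\<^sub>v s}"
    using det_nonzero_iff_mat_kernel by blast
  have cardI: "card {i. i < dim_row A \<and> i \<in> I} = s"
    and cardJ: "card {j. j < dim_col A \<and> j \<in> J} = s"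
    using B by (auto simp: dim_submatrix)
  have "{j. j < dim_col A \<and> j \<in> J} = {..<s}"
    using cardJ A by (intro card_subset_eq) auto
  then have J: "k \<in> J" if "k < s" for k using that by auto
  \<comment> \<open>\<open>J\<close> may also contain numbers from \<open>s\<close> on, but its
    increasing enumeration starts with all the column indices.\<close>
  have pickJ: "pick J k = k" if "k < s" for k
  proof -
    have "{a \<in> J. a < k} = {..<k}" using J that by auto
    then show ?thesis using pick_card_in_set[OF J[OF that]] by simp
  qed
  have pickI: "pick I i < m" if "i < s" for i
    using pick_le[of i "dim_row A" I] that cardI A by simp
  show "mat_kernel A = {0\<^sub>v s}"
    unfolding mat_kernel_trivial_iff[OF A]
  proof (intro allI impI)
    fix f k assume f: "\<forall>r<m. (\<Sum>k<s. A $$ (r, k) * f k) = 0" and "k < s"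
    have "\<forall>r<s. (\<Sum>k<s. submatrix A I J $$ (r, k) * f k) = 0"
      using f pickI by (auto simp: submatrix_index cardI cardJ pickJ)
    then show "f k = 0" using ker \<open>k < s\<close> unfolding mat_kernel_trivial_iff[OF B] by blast
  qed
qed

section \<open>Tiles\<close>

lemma lookup_scaleR [simp]: "Poly_Mapping.lookup (r *\<^sub>R x) p = r *\<^sub>R Poly_Mapping.lookup x p"
  by (simp add: scaleR_poly_mapping_def Poly_Mapping.map.rep_eq when_def)

lemma finite_tri_index: "finite (tri_index n)"
  by (rule finite_subset[of _ "{..n} \<times> {..n}"]) (auto simp: tri_index_def)

section \<open>Tiles as equivalence classes\<close>

text \<open>This is the upward half of adjacency. Inside the triangle the other half is its
  converse, which makes the symmetry of \<open>tile_step\<close> evident and avoids subtraction on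
  naturals.\<close>

definition row_above :: "nat \<times> nat \<Rightarrow> nat \<times> nat \<Rightarrow> bool" where
  "row_above p q \<longleftrightarrow> snd q = snd p + 1 \<and> (fst q = fst p \<or> fst q = fst p + 1)"

lemma tile_step_iff:
  "(p, q) \<in> tile_step n x \<longleftrightarrow> p \<in> tri_index n \<and> q \<in> tri_index n \<and>
    Poly_Mapping.lookup x q = Poly_Mapping.lookup x p \<and> (row_above p q \<or> row_above q p)"
proof -
  obtain i j i' j' where pq: "p = (i, j)" "q = (i', j')" by fastforce
  have "(i', j') \<in> {(i + 1, j + 1), (i, j + 1), (i - 1, j - 1), (i, j - 1)} \<longleftrightarrow>
      row_above p q \<or> row_above q p" if "p \<in> tri_index n" "q \<in> tri_index n"
  proof -
    have "1 \<le> i" "1 \<le> i'" "1 \<le> j" "1 \<le> j'" using that by (auto simp: pq tri_index_def)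
    then show ?thesis unfolding row_above_def pq insert_iff empty_iff prod.inject fst_conv snd_conv
      by arith
  qed
  then show ?thesis by (auto simp: tile_step_def pq)
qed

lemma sym_tile_step: "sym (tile_step n x)"
  by (rule symI) (auto simp: tile_step_iff)

text \<open>The carrier is \<open>UNIV\<close> because a reflexive closure is reflexive at every
  pair; pairs outside the triangle form singleton classes, which are not tiles.\<close>

lemma equiv_tile: "equiv UNIV ((tile_step n x)\<^sup>*)"
  by (intro equivI refl_rtrancl sym_rtrancl sym_tile_step trans_rtrancl) auto

lemma tiling_quotient: "P \<in> tiling n x \<Longrightarrow> P \<in> UNIV // (tile_step n x)\<^sup>*"
  by (auto simp: tiling_def quotient_def)

lemma tile_unique: "P \<in> tiling n x \<Longrightarrow> Q \<in> tiling n x \<Longrightarrow> p \<in> P \<Longrightarrow> p \<in> Q \<Longrightarrow> P = Q"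
  using quotient_disj[OF equiv_tile] tiling_quotient by blast

lemma tile_nonempty: "P \<in> tiling n x \<Longrightarrow> P \<noteq> {}"
  by (auto simp: tiling_def quotient_def)

lemma tile_cover: "p \<in> tri_index n \<Longrightarrow> \<exists>P\<in>tiling n x. p \<in> P"
  by (auto simp: tiling_def quotient_def)

lemma tile_subset: "P \<in> tiling n x \<Longrightarrow> P \<subseteq> tri_index n"
proof
  fix q assume "P \<in> tiling n x" "q \<in> P"
  then obtain p where p: "p \<in> tri_index n" and pq: "(p, q) \<in> (tile_step n x)\<^sup>*"
    by (auto simp: tiling_def quotient_def)
  from pq p show "q \<in> tri_index n"
    by (induction rule: rtrancl_induct) (auto simp: tile_step_def)
qed

lemma tile_step_closed: "P \<in> tiling n x \<Longrightarrow> p \<in> P \<Longrightarrow> (p, q) \<in> tile_step n x \<Longrightarrow> q \<in> P"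
  by (auto simp: tiling_def quotient_def intro: rtrancl_into_rtrancl)

lemma tile_invariant:
  assumes "P \<in> tiling n x" "p \<in> P" "q \<in> P"
    and "\<And>a b. (a, b) \<in> tile_step n x \<Longrightarrow> f a = f b"
  shows "f p = f q"
proof -
  have "(p, q) \<in> (tile_step n x)\<^sup>*"
    using quotient_eq_iff[OF equiv_tile] tiling_quotient[OF assms(1)] assms(2,3) by metis
  then show ?thesis by (induction rule: rtrancl_induct) (auto simp: assms(4))
qed

lemma finite_free_tiles: "finite (free_tiles n x)"
proof (rule finite_subset)
  show "free_tiles n x \<subseteq> Pow (tri_index n)"
    using tile_subset by (auto simp: free_tiles_def)
qed (simp add: finite_tri_index)

section \<open>Arrays given by weights on free tiles\<close>

text \<open>Tiles are disjoint, so only the summand of \<open>Q\<close> survives. The sum describes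
  the array with value \<open>w P\<close> on each free tile \<open>P\<close> and zero
  elsewhere.\<close>

lemma sum_tile_indicator:
  fixes w :: "(nat \<times> nat) set \<Rightarrow> 'a::semiring_1"
  assumes "Q \<in> free_tiles n x" "p \<in> Q"
  shows "(\<Sum>P\<in>free_tiles n x. w P * of_bool (p \<in> P)) = w Q"
proof -
  have "(\<Sum>P\<in>free_tiles n x. w P * of_bool (p \<in> P)) = (\<Sum>P\<in>free_tiles n x. if P = Q then w P else 0)"
    by (rule sum.cong) (use assms in \<open>auto simp: free_tiles_def dest: tile_unique\<close>)
  then show ?thesis using assms by (simp add: finite_free_tiles)
qed

text \<open>Exchanging the sums counts the entries of each tile in row \<open>j\<close>. For an
  inner row the right-hand side is a row of the tiling matrix applied to \<open>w\<close>, so kernel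
  vectors are the weights with zero inner row sums.\<close>

lemma row_sum_tile_weights:
  fixes w :: "(nat \<times> nat) set \<Rightarrow> 'a::comm_semiring_1"
  assumes "j \<le> n"
  shows "(\<Sum>i=1..j. \<Sum>P\<in>free_tiles n x. w P * of_bool ((i, j) \<in> P)) =
    (\<Sum>P\<in>free_tiles n x. of_nat (card {i. (i, j) \<in> P}) * w P)"
proof -
  have "(\<Sum>i=1..j. w P * of_bool ((i, j) \<in> P)) = of_nat (card {i. (i, j) \<in> P}) * w P"
    if "P \<in> free_tiles n x" for P
  proof -
    have "{i. (i, j) \<in> P} = {1..j} \<inter> {i. (i, j) \<in> P}"
      using that tile_subset[of P n x] by (auto simp: free_tiles_def tri_index_def)
    then show ?thesis
      by (simp add: sum_distrib_left[symmetric] sum_of_bool_eq mult.commute)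
  qed
  then show ?thesis by (subst sum.swap) simp
qed

text \<open>
  A zero at \<open>(i, j)\<close> forces a zero at \<open>(i + 1, j + 1)\<close>, so a tile of value zero runs along a
  diagonal up to row \<open>n\<close>.
\<close>

lemma free_tile_positive:
  assumes "GT_pattern n x" "P \<in> free_tiles n x" "(i, j) \<in> P"
  shows "0 < entry x i j"
proof (rule ccontr)
  have P: "P \<in> tiling n x" using assms by (simp add: free_tiles_def)
  have tri: "(i, j) \<in> tri_index n" if "(i, j) \<in> P" for i j using tile_subset[OF P] that by blast
  assume "\<not> 0 < entry x i j"
  then have "entry x i j = 0"
    using assms(1) tri[OF assms(3)] by (auto simp: GT_pattern_def tri_index_def intro: antisym)
  then have "\<exists>i. (i, n) \<in> P"
    using assms(3)
  proof (induction "n - j" arbitrary: i j)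
    case 0
    then have "j = n" using tri[OF \<open>(i, j) \<in> P\<close>] by (auto simp: tri_index_def)
    then show ?case using 0 by auto
  next
    case (Suc d)
    have t: "(i, j) \<in> tri_index n" by (rule tri) fact
    with Suc(2) have t': "(i + 1, j + 1) \<in> tri_index n" by (auto simp: tri_index_def)
    have "entry x (i + 1) (j + 1) \<le> entry x i j" "0 \<le> entry x (i + 1) (j + 1)"
      using assms(1) t t' by (auto simp: GT_pattern_def tri_index_def)
    then have zero: "entry x (i + 1) (j + 1) = 0" using Suc(3) by simp
    then have "((i, j), (i + 1, j + 1)) \<in> tile_step n x"
      using t t' Suc(3) by (simp add: tile_step_def)
    then have "(i + 1, j + 1) \<in> P" using tile_step_closed[OF P \<open>(i, j) \<in> P\<close>] by blast
    then show ?case using Suc(1)[of "j + 1" "i + 1"] Suc(2) zero by auto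
  qed
  then obtain k where k: "(k, n) \<in> P" ..
  then show False using assms(2) tri[OF k] by (auto simp: free_tiles_def tri_index_def)
qed

section \<open>Vertices\<close>

lemma small_perturbation_nonneg:
  fixes g h :: "'c \<Rightarrow> real"
  assumes "finite C" "\<And>c. c \<in> C \<Longrightarrow> 0 < g c"
  shows "\<forall>\<^sub>F t in nhds 0. \<forall>c\<in>C. 0 \<le> g c + t * h c"
proof (intro eventually_ball_finite assms(1) ballI)
  fix c assume "c \<in> C"
  have "((\<lambda>t. g c + t * h c) \<longlongrightarrow> g c + 0 * h c) (nhds 0)"
    by (intro tendsto_intros filterlim_ident)
  from order_tendstoD(1)[OF this, of 0] assms(2)[OF \<open>c \<in> C\<close>]
  show "\<forall>\<^sub>F t in nhds 0. 0 \<le> g c + t * h c" by (auto elim: eventually_mono)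
qed

text \<open>The weight conditions telescope, starting from the prescribed entry at
  \<open>(1, 1)\<close>. Hence any two points of the polytope have the same row sums.\<close>

lemma GT_polytope_row_sum:
  assumes "x \<in> GT_polytope n l m" "1 \<le> j" "j \<le> n"
  shows "(\<Sum>i=1..j. entry x i j) = (\<Sum>k=1..j. of_int (m k))"
  using assms(2,3)
proof (induction j rule: nat_induct_at_least)
  case base
  then show ?case using assms(1) by (simp add: GT_polytope_def)
next
  case (Suc j)
  have "(\<Sum>i=1..Suc j. entry x i (Suc j)) - (\<Sum>i=1..j. entry x i j) = of_int (m (Suc j))"
    using assms(1) Suc by (auto simp: GT_polytope_def dest!: bspec[of _ _ "Suc j"])
  then show ?case using Suc by simp
qed

text \<open>Since \<open>nhds 0\<close> contains both signs of \<open>t\<close>, this shows that the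
  point can move along \<open>d\<close> in both directions.\<close>

lemma GT_polytope_perturbation:
  assumes x: "x \<in> GT_polytope n l m"
    and ker: "\<And>j. j \<in> {2..n - 1} \<Longrightarrow>
      (\<Sum>P\<in>free_tiles n x. of_nat (card {i. (i, j) \<in> P}) * w P) = 0"
    and d: "\<And>p. Poly_Mapping.lookup d p = (\<Sum>P\<in>free_tiles n x. w P * of_bool (p \<in> P))"
  shows "\<forall>\<^sub>F t in nhds 0. x + t *\<^sub>R d \<in> GT_polytope n l m"
proof -
  let ?x = "Poly_Mapping.lookup x" and ?d = "Poly_Mapping.lookup d"
  have pat: "GT_pattern n x" using x by (simp add: GT_polytope_def)
  have d_step: "?d p = ?d q" if "(p, q) \<in> tile_step n x" for p q
  proof -
    have "p \<in> P \<longleftrightarrow> q \<in> P" if "P \<in> free_tiles n x" for P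
      using that tile_step_closed \<open>(p, q) \<in> tile_step n x\<close> symD[OF sym_tile_step \<open>(p, q) \<in> tile_step n x\<close>]
      unfolding free_tiles_def by blast
    then show ?thesis unfolding d by (intro sum.cong) auto
  qed
  have d_zero: "?d p = 0" if "\<And>P. P \<in> free_tiles n x \<Longrightarrow> p \<notin> P" for p
    unfolding d using that by (auto intro!: sum.neutral)
  have d_bottom: "?d (1, 1) = 0" by (rule d_zero) (simp add: free_tiles_def)
  have d_top: "?d (i, n) = 0" if "1 \<le> i" "i \<le> n" for i
    by (rule d_zero) (use that in \<open>auto simp: free_tiles_def\<close>)
  have d_outside: "?d p = 0" if "p \<notin> tri_index n" for p
    by (rule d_zero) (use that tile_subset in \<open>auto simp: free_tiles_def\<close>)
  \<comment> \<open>Entries that are zero lie in no free tile and stay zero, so nonnegativity is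
    only at stake where the entry is positive.\<close>
  have d_null: "?d (i, j) = 0" if "?x (i, j) = 0" for i j
    by (rule d_zero) (use that free_tile_positive[OF pat] in force)
  have d_row: "(\<Sum>i=1..j. ?d (i, j)) = 0" if "1 \<le> j" "j \<le> n" for j
  proof -
    \<comment> \<open>Rows \<open>1\<close> and \<open>n\<close> have no equation in the kernel
      condition, but \<open>d\<close> vanishes on them.\<close>
    have "j = 1 \<or> j = n \<or> j \<in> {2..n - 1}" using that by auto
    then consider "j = 1" | "j = n" | "j \<in> {2..n - 1}" by blast
    then show ?thesis
    proof cases
      case 3
      then show ?thesis using ker[OF 3] row_sum_tile_weights[OF \<open>j \<le> n\<close>, of w x] by (simp add: d)
    qed (use d_bottom d_top in auto)
  qed
  \<comment> \<open>\<open>C\<close> and \<open>D\<close> collect the strict inequalities at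
    \<open>x\<close>. \<open>D\<close> includes pairs that are not neighbours, which is harmless
    because it is still finite.\<close>
  define C where "C = {p \<in> tri_index n. 0 < ?x p}"
  define D where "D = {(p, q) \<in> tri_index n \<times> tri_index n. ?x q < ?x p}"
  have "finite C" "finite D"
    unfolding C_def D_def
    by (rule finite_subset[OF _ finite_tri_index], auto)
      (rule finite_subset[OF _ finite_cartesian_product[OF finite_tri_index finite_tri_index]], auto)
  have "\<forall>\<^sub>F t in nhds 0. \<forall>p\<in>C. 0 \<le> ?x p + t * ?d p"
    by (rule small_perturbation_nonneg) (use \<open>finite C\<close> in \<open>auto simp: C_def\<close>)
  moreover have "\<forall>\<^sub>F t in nhds 0. \<forall>c\<in>D. 0 \<le> (?x (fst c) - ?x (snd c)) + t * (?d (fst c) - ?d (snd c))"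
    by (rule small_perturbation_nonneg) (use \<open>finite D\<close> in \<open>auto simp: D_def\<close>)
  ultimately show ?thesis
  proof eventually_elim
    case (elim t)
    let ?y = "x + t *\<^sub>R d"
    have y: "Poly_Mapping.lookup ?y p = ?x p + t * ?d p" for p by (simp add: lookup_add)
    \<comment> \<open>Equal neighbours lie in one tile and move together; a strict gap is covered by
      \<open>D\<close>.\<close>
    have mono: "Poly_Mapping.lookup ?y q \<le> Poly_Mapping.lookup ?y p"
      if "p \<in> tri_index n" "q \<in> tri_index n" "?x q \<le> ?x p"
        and step: "?x q = ?x p \<Longrightarrow> (p, q) \<in> tile_step n x" for p q
    proof (cases "?x q = ?x p")
      case True
      then show ?thesis using d_step[OF step] by (simp add: y)
    next
      case False
      then have "(p, q) \<in> D" using that by (auto simp: D_def)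
      then show ?thesis using elim(2) by (fastforce simp: y algebra_simps)
    qed
    have "?y \<in> tri_arrays n"
    proof -
      have "?y \<in> tri_arrays n \<longleftrightarrow> (\<forall>p. p \<notin> tri_index n \<longrightarrow> Poly_Mapping.lookup ?y p = 0)"
        unfolding tri_arrays_def using in_keys_iff[of _ ?y] by blast
      moreover have "?x p = 0" if "p \<notin> tri_index n" for p
        using pat that in_keys_iff[of p x] by (auto simp: GT_pattern_def tri_arrays_def)
      ultimately show ?thesis by (simp add: y d_outside)
    qed
    moreover have "0 \<le> entry ?y i j" if "1 \<le> i" "i \<le> j" "j \<le> n" for i j
    proof (cases "?x (i, j) = 0")
      case True
      then show ?thesis using d_null by (simp add: y)
    next
      case False
      then have "(i, j) \<in> C"
        using pat that by (auto simp: C_def tri_index_def GT_pattern_def less_le)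
      then show ?thesis using elim(1) by (simp add: y)
    qed
    moreover have "entry ?y i j \<le> entry ?y i (j + 1) \<and> entry ?y (i + 1) (j + 1) \<le> entry ?y i j"
      if "1 \<le> i" "i \<le> j" "j \<le> n - 1" for i j
    proof -
      have tri: "(i, j) \<in> tri_index n" "(i, j + 1) \<in> tri_index n" "(i + 1, j + 1) \<in> tri_index n"
        using that by (auto simp: tri_index_def)
      have le: "?x (i, j) \<le> ?x (i, j + 1)" "?x (i + 1, j + 1) \<le> ?x (i, j)"
        using pat that by (auto simp: GT_pattern_def)
      show ?thesis
        by (intro conjI mono tri le) (use tri in \<open>auto simp: tile_step_def\<close>)
    qed
    ultimately have "GT_pattern n ?y" by (auto simp: GT_pattern_def)
    moreover have "entry ?y i n = of_int (l i)" if "i \<in> {1..n}" for i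
      using x that d_top by (auto simp: GT_polytope_def y)
    moreover have "entry ?y 1 1 = of_int (m 1)"
      using x d_bottom by (simp add: GT_polytope_def y)
    moreover have "(\<Sum>i=1..j. entry ?y i j) - (\<Sum>i=1..j-1. entry ?y i (j - 1)) = of_int (m j)"
      if "j \<in> {2..n}" for j
    proof -
      have "(\<Sum>i=1..k. entry ?y i k) = (\<Sum>i=1..k. entry x i k)" if "1 \<le> k" "k \<le> n" for k
        using d_row[OF that] by (simp add: y sum.distrib sum_distrib_left[symmetric])
      from this[of j] this[of "j - 1"] show ?thesis
        using x that by (auto simp: GT_polytope_def)
    qed
    ultimately show "?y \<in> GT_polytope n l m" by (auto simp: GT_polytope_def)
  qed
qed

section \<open>Segments through the point\<close>

text \<open>The gaps \<open>a' - a\<close> and \<open>b' - b\<close> are nonnegative and have a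
  positive combination equal to zero, so both vanish.\<close>

lemma convex_comb_eq_imp_eq:
  fixes u :: real
  assumes "0 < u" "u < 1" "a \<le> a'" "b \<le> b'" "(1 - u) * a + u * b = (1 - u) * a' + u * b'"
  shows "a = a' \<and> b = b'"
proof -
  have "(1 - u) * (a' - a) + u * (b' - b) = 0" using assms(5) by (simp add: algebra_simps)
  moreover have "0 \<le> (1 - u) * (a' - a)" "0 \<le> u * (b' - b)" using assms by auto
  ultimately have "(1 - u) * (a' - a) = 0" "u * (b' - b) = 0" by linarith+
  then show ?thesis using assms by auto
qed

text \<open>The order of two neighbouring entries is the same in every pattern, so \<open>a\<close>
  and \<open>b\<close> cannot compensate each other: equality at an interior point of the segment
  forces it at both ends.\<close>

lemma tile_step_segment:
  assumes "GT_pattern n a" "GT_pattern n b" "0 < u" "u < 1"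
    and x: "x = (1 - u) *\<^sub>R a + u *\<^sub>R b"
    and step: "(p, q) \<in> tile_step n x"
  shows "Poly_Mapping.lookup a p = Poly_Mapping.lookup a q \<and>
    Poly_Mapping.lookup b p = Poly_Mapping.lookup b q"
proof -
  define le where "le p q \<longleftrightarrow> Poly_Mapping.lookup a p \<le> Poly_Mapping.lookup a q \<and>
    Poly_Mapping.lookup b p \<le> Poly_Mapping.lookup b q" for p q
  have up: "le (i, j) (i, j + 1)" "le (i + 1, j + 1) (i, j)"
    if "(i, j) \<in> tri_index n" "j + 1 \<le> n" for i j
    using assms(1,2) that by (auto simp: GT_pattern_def tri_index_def le_def)
  have above: "le p q \<or> le q p" if "p \<in> tri_index n" "q \<in> tri_index n" "row_above p q" for p q
  proof -
    obtain i j where p: "p = (i, j)" by fastforce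
    then have "j + 1 \<le> n" "q = (i, j + 1) \<or> q = (i + 1, j + 1)"
      using that(2,3) by (auto simp: row_above_def tri_index_def prod_eq_iff)
    then show ?thesis using up that(1) unfolding p by blast
  qed
  have "le p q \<or> le q p"
    using step above[of p q] above[of q p] unfolding tile_step_iff by blast
  moreover have "Poly_Mapping.lookup x p = Poly_Mapping.lookup x q"
    using step by (simp add: tile_step_iff)
  ultimately show ?thesis
    using convex_comb_eq_imp_eq[OF assms(3,4)]
    unfolding le_def x lookup_add lookup_scaleR real_scaleR_def by metis
qed

text \<open>A kernel weight gives a direction \<open>d\<close> with \<open>x\<close> as the midpoint
  of two points of the polytope, and a segment around \<open>x\<close> gives back a kernel weight,
  namely the value of \<open>b - a\<close> on each free tile.\<close>

lemma extreme_point_GT_polytope_iff: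
  assumes x: "x \<in> GT_polytope n l m"
  shows "x extreme_point_of GT_polytope n l m \<longleftrightarrow>
    (\<forall>w :: (nat \<times> nat) set \<Rightarrow> real.
      (\<forall>j\<in>{2..n - 1}. (\<Sum>P\<in>free_tiles n x. of_nat (card {i. (i, j) \<in> P}) * w P) = 0) \<longrightarrow>
      (\<forall>P\<in>free_tiles n x. w P = 0))"
proof (intro iffI allI impI ballI)
  fix w :: "(nat \<times> nat) set \<Rightarrow> real" and Q
  assume ext: "x extreme_point_of GT_polytope n l m" and Q: "Q \<in> free_tiles n x"
    and ker: "\<forall>j\<in>{2..n - 1}. (\<Sum>P\<in>free_tiles n x. of_nat (card {i. (i, j) \<in> P}) * w P) = 0"
  define f where "f p = (\<Sum>P\<in>free_tiles n x. w P * of_bool (p \<in> P))" for p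
  \<comment> \<open>Finite support is what makes \<open>Abs_poly_mapping f\<close> an array with
    entries \<open>f\<close>.\<close>
  have "{p. f p \<noteq> 0} \<subseteq> tri_index n"
  proof (intro subsetI, rule ccontr)
    fix p assume "p \<in> {p. f p \<noteq> 0}" "p \<notin> tri_index n"
    moreover from this(2) have "f p = 0"
      unfolding f_def using tile_subset by (intro sum.neutral) (auto simp: free_tiles_def)
    ultimately show False by simp
  qed
  then have fin: "finite {p. f p \<noteq> 0}" using finite_subset finite_tri_index by blast
  define d where "d = Abs_poly_mapping f"
  have d: "Poly_Mapping.lookup d p = f p" for p
    unfolding d_def using lookup_Abs_poly_mapping[OF fin] by simp
  have "\<forall>\<^sub>F t in nhds 0. x + t *\<^sub>R d \<in> GT_polytope n l m"
    using GT_polytope_perturbation[OF x] ker d unfolding f_def by blast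
  then obtain e where e: "0 < e" "\<And>t. dist t 0 < e \<Longrightarrow> x + t *\<^sub>R d \<in> GT_polytope n l m"
    unfolding eventually_nhds_metric by blast
  \<comment> \<open>Half of \<open>e\<close> keeps both points strictly within the radius where
    membership is known.\<close>
  define a b where "a = x + (- (e / 2)) *\<^sub>R d" and "b = x + (e / 2) *\<^sub>R d"
  have ab: "a \<in> GT_polytope n l m" "b \<in> GT_polytope n l m"
    unfolding a_def b_def by (rule e(2); use e(1) in simp)+
  have mid: "x = (1 - 1 / 2) *\<^sub>R a + (1 / 2) *\<^sub>R b"
  proof (rule poly_mapping_eqI)
    have "r = (1 - 1 / 2) * (r + - (e / 2) * s) + 1 / 2 * (r + e / 2 * s)" for r s :: real
      by (simp add: field_simps)
    then show "Poly_Mapping.lookup x p = Poly_Mapping.lookup ((1 - 1 / 2) *\<^sub>R a + (1 / 2) *\<^sub>R b) p" for p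
      unfolding a_def b_def lookup_add lookup_scaleR real_scaleR_def .
  qed
  have "d = 0"
  proof (rule ccontr)
    assume "d \<noteq> 0"
    have "b - a = e *\<^sub>R d" unfolding a_def b_def by (simp add: scaleR_left_distrib[symmetric])
    then have "a \<noteq> b" using e(1) \<open>d \<noteq> 0\<close> by auto
    then have "x \<in> open_segment a b"
      unfolding in_segment using mid by (intro conjI exI[of _ "1/2"]) auto
    then show False using ext ab by (auto simp: extreme_point_of_def)
  qed
  moreover obtain p where "p \<in> Q" using Q tile_nonempty[of Q n x] by (auto simp: free_tiles_def)
  ultimately show "w Q = 0"
    using sum_tile_indicator[OF Q \<open>p \<in> Q\<close>, of w] d[of p] by (simp add: f_def)
next
  assume inj: "\<forall>w :: (nat \<times> nat) set \<Rightarrow> real.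
      (\<forall>j\<in>{2..n - 1}. (\<Sum>P\<in>free_tiles n x. of_nat (card {i. (i, j) \<in> P}) * w P) = 0) \<longrightarrow>
      (\<forall>P\<in>free_tiles n x. w P = 0)"
  show "x extreme_point_of GT_polytope n l m"
    unfolding extreme_point_of_def
  proof (intro conjI x ballI notI)
    fix a b assume a: "a \<in> GT_polytope n l m" and b: "b \<in> GT_polytope n l m"
      and "x \<in> open_segment a b"
    then obtain u where "a \<noteq> b" and u: "0 < u" "u < 1" "x = (1 - u) *\<^sub>R a + u *\<^sub>R b"
      unfolding in_segment by blast
    have pat: "GT_pattern n a" "GT_pattern n b" using a b by (auto simp: GT_polytope_def)
    define f where "f p = Poly_Mapping.lookup b p - Poly_Mapping.lookup a p" for p
    have f_step: "f p = f q" if "(p, q) \<in> tile_step n x" for p q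
      using tile_step_segment[OF pat u that] by (simp add: f_def)
    \<comment> \<open>Any representative will do, as \<open>f\<close> is constant on tiles.\<close>
    define w where "w P = f (SOME p. p \<in> P)" for P
    have w: "f p = w P" if "P \<in> tiling n x" "p \<in> P" for p P
      unfolding w_def by (rule tile_invariant[OF that someI[of "\<lambda>p. p \<in> P", OF that(2)] f_step])
    have f_bottom: "f (1, 1) = 0" using a b by (simp add: f_def GT_polytope_def)
    have f_top: "f (i, n) = 0" if "i \<in> {1..n}" for i
      using a b that by (simp add: f_def GT_polytope_def)
    have f_eq: "f p = (\<Sum>P\<in>free_tiles n x. w P * of_bool (p \<in> P))" if p: "p \<in> tri_index n" for p
    proof -
      obtain Q where Q: "Q \<in> tiling n x" "p \<in> Q" using tile_cover[OF p] by blast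
      show ?thesis
      proof (cases "Q \<in> free_tiles n x")
        case True
        then show ?thesis using sum_tile_indicator[OF True Q(2), of w] w[OF Q] by simp
      next
        case False
        \<comment> \<open>A tile that is not free contains \<open>(1, 1)\<close> or an entry of row
          \<open>n\<close>, where \<open>a\<close> and \<open>b\<close> agree.\<close>
        then have "w Q = 0"
          using Q(1) w[OF Q(1)] f_bottom f_top by (fastforce simp: free_tiles_def)
        moreover have "(\<Sum>P\<in>free_tiles n x. w P * of_bool (p \<in> P)) = 0"
          by (rule sum.neutral) (use False Q tile_unique in \<open>fastforce simp: free_tiles_def\<close>)
        ultimately show ?thesis using w[OF Q] by simp
      qed
    qed
    have "(\<Sum>P\<in>free_tiles n x. of_nat (card {i. (i, j) \<in> P}) * w P) = 0" if "j \<in> {2..n - 1}" for j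
    proof -
      have j: "1 \<le> j" "j \<le> n" using that by auto
      have "(\<Sum>P\<in>free_tiles n x. of_nat (card {i. (i, j) \<in> P}) * w P) = (\<Sum>i=1..j. f (i, j))"
        unfolding row_sum_tile_weights[OF j(2), symmetric]
        by (rule sum.cong) (use j in \<open>auto simp: f_eq tri_index_def\<close>)
      also have "\<dots> = 0"
        unfolding f_def sum_subtractf
        using GT_polytope_row_sum[OF a j] GT_polytope_row_sum[OF b j] by simp
      finally show ?thesis .
    qed
    then have "\<forall>P\<in>free_tiles n x. w P = 0" using inj by blast
    then have tri: "f p = 0" if "p \<in> tri_index n" for p using f_eq[OF that] by simp
    have "f p = 0" if "p \<notin> tri_index n" for p
      using pat that in_keys_iff[of p a] in_keys_iff[of p b]
      by (auto simp: f_def GT_pattern_def tri_arrays_def)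
    with tri have "f p = 0" for p by blast
    then have "a = b" by (intro poly_mapping_eqI) (simp add: f_def)
    then show False using \<open>a \<noteq> b\<close> by simp
  qed
qed

section \<open>From tile weights to the tiling matrix\<close>

text \<open>As \<open>Ps\<close> is distinct, it is a bijection between column indices and tiles,
  which matches coefficient vectors with weights.\<close>

lemma mat_kernel_tiling_matrix_iff:
  fixes Ps :: "(nat \<times> nat) set list"
  assumes "distinct Ps"
  shows "mat_kernel (tiling_matrix n Ps) = {0\<^sub>v (length Ps)} \<longleftrightarrow>
    (\<forall>w :: (nat \<times> nat) set \<Rightarrow> real.
      (\<forall>j\<in>{2..n - 1}. (\<Sum>P\<in>set Ps. of_nat (card {i. (i, j) \<in> P}) * w P) = 0) \<longrightarrow>
      (\<forall>P\<in>set Ps. w P = 0))"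
    (is "?L \<longleftrightarrow> ?R")
proof -
  let ?s = "length Ps"
  have A: "tiling_matrix n Ps \<in> carrier_mat (n - 2) ?s" by (simp add: tiling_matrix_def)
  have bij: "bij_betw (nth Ps) {..<?s} (set Ps)"
    using assms by (intro bij_betw_nth) auto
  \<comment> \<open>This is the shift by two between rows of the triangle and rows of the matrix;
    for \<open>n \<le> 2\<close> both ranges are empty.\<close>
  have rows: "(\<forall>j\<in>{2..n - 1}. Q j) \<longleftrightarrow> (\<forall>r<n - 2. Q (r + 2))" for Q
  proof
    assume Q: "\<forall>r<n - 2. Q (r + 2)"
    show "\<forall>j\<in>{2..n - 1}. Q j"
    proof
      fix j assume "j \<in> {2..n - 1}"
      then have "j - 2 < n - 2" "j - 2 + 2 = j" by auto
      then show "Q j" using Q by metis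
    qed
  qed auto
  have row: "(\<Sum>P\<in>set Ps. of_nat (card {i. (i, r + 2) \<in> P}) * w P) =
      (\<Sum>k<?s. tiling_matrix n Ps $$ (r, k) * w (Ps ! k))" if "r < n - 2" for r and w :: "(nat \<times> nat) set \<Rightarrow> real"
    using that by (subst sum.reindex_bij_betw[OF bij, symmetric]) (simp add: tiling_matrix_def)
  have "?R \<longleftrightarrow>
      (\<forall>w :: (nat \<times> nat) set \<Rightarrow> real. (\<forall>r<n - 2. (\<Sum>k<?s. tiling_matrix n Ps $$ (r, k) * w (Ps ! k)) = 0) \<longrightarrow>
      (\<forall>k<?s. w (Ps ! k) = 0))"
    unfolding rows by (simp add: row all_set_conv_all_nth del: add_2_eq_Suc')
  also have "\<dots> \<longleftrightarrow> (\<forall>f. (\<forall>r<n - 2. (\<Sum>k<?s. tiling_matrix n Ps $$ (r, k) * f k) = 0) \<longrightarrow>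
      (\<forall>k<?s. f k = 0))"
    (is "(\<forall>w. ?A (\<lambda>k. w (Ps ! k))) \<longleftrightarrow> (\<forall>f. ?A f)")
  proof (intro iffI allI)
    fix f assume all: "\<forall>w. ?A (\<lambda>k. w (Ps ! k))"
    \<comment> \<open>Inverting the enumeration turns a vector of coefficients into a weight on
      tiles; its values outside \<open>set Ps\<close> are never read.\<close>
    define w :: "(nat \<times> nat) set \<Rightarrow> real" where "w P = f (the_inv_into {..<?s} (nth Ps) P)" for P
    have w: "w (Ps ! k) = f k" if "k < ?s" for k
      unfolding w_def using that bij
      by (subst the_inv_into_f_f) (auto simp: bij_betw_def)
    have "(\<Sum>k<?s. tiling_matrix n Ps $$ (r, k) * w (Ps ! k)) =
        (\<Sum>k<?s. tiling_matrix n Ps $$ (r, k) * f k)" for r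
      by (rule sum.cong) (simp_all add: w)
    with all[rule_format, of w] show "?A f" by (metis w)
  next
    fix w :: "(nat \<times> nat) set \<Rightarrow> real"
    assume "\<forall>f. ?A f"
    then show "?A (\<lambda>k. w (Ps ! k))" by (rule spec)
  qed
  also have "\<dots> \<longleftrightarrow> ?L" unfolding mat_kernel_trivial_iff[OF A] ..
  finally show ?thesis ..
qed

text \<open>\<open>Ps\<close> is an arbitrary enumeration of the free tiles, so the result holds for
  every order of the columns. The index sets \<open>I\<close> and \<open>J\<close> select the rows
  and columns of the minor.\<close>

theorem corollary1p6:
  fixes n s :: nat
    and l m :: "nat \<Rightarrow> int"
    and x :: tri_array
    and Ps :: "(nat \<times> nat) set list"
    and A :: "real mat"
  assumes "n \<ge> 1"
    and "x \<in> GT_polytope n l m"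
    and "distinct Ps" and "set Ps = free_tiles n x" and "length Ps = s"
    and "A = tiling_matrix n Ps"
  shows "(x extreme_point_of GT_polytope n l m \<longleftrightarrow> mat_kernel A = {0\<^sub>v s})
    \<and> (mat_kernel A = {0\<^sub>v s} \<longleftrightarrow>
        (\<exists>I J. submatrix A I J \<in> carrier_mat s s \<and> det (submatrix A I J) \<noteq> 0))"
proof
  show "x extreme_point_of GT_polytope n l m \<longleftrightarrow> mat_kernel A = {0\<^sub>v s}"
    using extreme_point_GT_polytope_iff[OF assms(2)] mat_kernel_tiling_matrix_iff[OF assms(3), of n]
    unfolding assms(4-6) by simp
  have "A \<in> carrier_mat (n - 2) s" using assms(5,6) by (simp add: tiling_matrix_def)
  then show "mat_kernel A = {0\<^sub>v s} \<longleftrightarrow>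
      (\<exists>I J. submatrix A I J \<in> carrier_mat s s \<and> det (submatrix A I J) \<noteq> 0)"
    by (rule mat_kernel_trivial_iff_minor)
qed

end
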